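(* Let $\omega$ be a non-principal ultrafilter over $\mathbb N$ and let $(n_k)_{k\in\mathbb N}$ be a sequence of positive integers. A sequence $(p_k)_{k\in\mathbb N}\in\Pi_{k\in\mathbb N}S_{n_k}$ has stable centralizer if and only if $cyc_\infty(\Pi_{k\to\omega}p_k)=0$.
   Context: $S_n$ is the symmetric group on $\{1,\ldots,n\}$ with identity $1_n$, and $d_H(p,q)=\frac1n\mathrm{Card}\{i:p(i)\neq q(i)\}$ is the normalized Hamming distance. The universal sofic group is $\Pi_{k\to\omega}S_{n_k}=\Pi_{k\in\mathbb N}S_{n_k}/\{(p_k)_k:\lim_{k\to\omega}d_H(p_k,1_{n_k})=0\}$; the class of $(p_k)_k$ is denoted $\Pi_{k\to\omega}p_k$. For $p\in S_n$, a cycle of $p$ is an orbit $c\subseteq\{1,\ldots,n\}$ of $p$ (fixed points are cycles of length $1$), with length $\mathrm{Card}(c)$. For an integer $i\geqslant1$, $cyc_i(p)=\frac1n\mathrm{Card}\{x: x\in c,\ c\text{ a cycle of }p,\ \mathrm{Card}(c)=i\}$. For $p=\Pi_{k\to\omega}p_k$, $cyc_i(p)=\lim_{k\to\omega}cyc_i(p_k)$ and $cyc_\infty(p)=1-\sum_{i\geqslant1}cyc_i(p)\geqslant0$. The sequence $(p_k)_{k\in\mathbb N}$, with $p=\Pi_{k\to\omega}p_k$, has stable centralizer (in permutations) if for any $q\in\Pi_{k\to\omega}S_{n_k}$ with $pq=qp$ there exist $q_k\in S_{n_k}$ such that $q=\Pi_{k\to\omega}q_k$ and $p_kq_k=q_kp_k$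 for every $k\in\mathbb N$. *)

theory Defs
  imports
    "HOL-Analysis.Analysis"
    "HOL-Algebra.Sym_Groups"
    "HOL-Algebra.Product_Groups"
    "HOL-Combinatorics.Orbits"
begin

text \<open>A filter \<open>\<omega>\<close> is identified with the family of sets \<open>{k. P k}\<close> such that
  \<open>eventually P \<omega>\<close>; then \<open>lim\<^bsub>k\<rightarrow>\<omega>\<^esub> f k = l\<close> reads \<open>(f \<longlongrightarrow> l) \<omega>\<close>.\<close>

definition ultrafilter :: "'a filter \<Rightarrow> bool" where
  "ultrafilter \<omega> \<longleftrightarrow>
     \<omega> \<noteq> bot \<and> (\<forall>P. eventually P \<omega> \<or> eventually (\<lambda>x. \<not> P x) \<omega>)"

definition nonprincipal_ultrafilter :: "'a filter \<Rightarrow> bool" where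
  "nonprincipal_ultrafilter \<omega> \<longleftrightarrow> ultrafilter \<omega> \<and> (\<forall>x. \<omega> \<noteq> principal {x})"

definition hamming :: "nat \<Rightarrow> (nat \<Rightarrow> nat) \<Rightarrow> (nat \<Rightarrow> nat) \<Rightarrow> real" where
  "hamming n p q = real (card {i \<in> {1..n}. p i \<noteq> q i}) / real n"

definition sym_product :: "(nat \<Rightarrow> nat) \<Rightarrow> (nat \<Rightarrow> nat \<Rightarrow> nat) monoid" where
  "sym_product n = product_group UNIV (\<lambda>k. sym_group (n k))"

definition null_sequences :: "nat filter \<Rightarrow> (nat \<Rightarrow> nat) \<Rightarrow> (nat \<Rightarrow> nat \<Rightarrow> nat) set" where
  "null_sequences \<omega> n =
     {p \<in> carrier (sym_product n).
        ((\<lambda>k. hamming (n k) (p k) \<one>\<^bsub>sym_group (n k)\<^esub>) \<longlongrightarrow> 0) \<omega>}"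

definition universal_sofic_group ::
    "nat filter \<Rightarrow> (nat \<Rightarrow> nat) \<Rightarrow> (nat \<Rightarrow> nat \<Rightarrow> nat) set monoid" where
  "universal_sofic_group \<omega> n = sym_product n Mod null_sequences \<omega> n"

definition sofic_class ::
    "nat filter \<Rightarrow> (nat \<Rightarrow> nat) \<Rightarrow> (nat \<Rightarrow> nat \<Rightarrow> nat) \<Rightarrow> (nat \<Rightarrow> nat \<Rightarrow> nat) set" where
  "sofic_class \<omega> n p = null_sequences \<omega> n #>\<^bsub>sym_product n\<^esub> p"

definition perm_cycles :: "nat \<Rightarrow> (nat \<Rightarrow> nat) \<Rightarrow> nat set set" where
  "perm_cycles n p = orbit p ` {1..n}"

definition cyc :: "nat \<Rightarrow> nat \<Rightarrow> (nat \<Rightarrow> nat) \<Rightarrow> real" where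
  "cyc i n p = real (card {x. \<exists>c \<in> perm_cycles n p. x \<in> c \<and> card c = i}) / real n"

text \<open>The limit does not depend on the representative: see \<open>sofic_cyc_tendsto\<close> below.\<close>

definition sofic_cyc ::
    "nat filter \<Rightarrow> (nat \<Rightarrow> nat) \<Rightarrow> nat \<Rightarrow> (nat \<Rightarrow> nat \<Rightarrow> nat) set \<Rightarrow> real" where
  "sofic_cyc \<omega> n i P = (THE l. \<forall>p \<in> P. ((\<lambda>k. cyc i (n k) (p k)) \<longlongrightarrow> l) \<omega>)"

definition sofic_cyc_inf ::
    "nat filter \<Rightarrow> (nat \<Rightarrow> nat) \<Rightarrow> (nat \<Rightarrow> nat \<Rightarrow> nat) set \<Rightarrow> real" where
  "sofic_cyc_inf \<omega> n P = 1 - (\<Sum>i. sofic_cyc \<omega> n (Suc i) P)"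

definition stable_centralizer ::
    "nat filter \<Rightarrow> (nat \<Rightarrow> nat) \<Rightarrow> (nat \<Rightarrow> nat \<Rightarrow> nat) \<Rightarrow> bool" where
  "stable_centralizer \<omega> n p \<longleftrightarrow>
     (\<forall>Q \<in> carrier (universal_sofic_group \<omega> n).
        sofic_class \<omega> n p \<otimes>\<^bsub>universal_sofic_group \<omega> n\<^esub> Q
          = Q \<otimes>\<^bsub>universal_sofic_group \<omega> n\<^esub> sofic_class \<omega> n p \<longrightarrow>
        (\<exists>q \<in> carrier (sym_product n). Q = sofic_class \<omega> n q \<and>
           (\<forall>k. p k \<otimes>\<^bsub>sym_group (n k)\<^esub> q k = q k \<otimes>\<^bsub>sym_group (n k)\<^esub> p k)))"


subsection \<open>Well-definedness\<close>

lemma carrier_sym_product: "p \<in> carrier (sym_product n) \<longleftrightarrow> (\<forall>k. p k permutes {1..n k})"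
  by (auto simp: sym_product_def sym_group_def PiE_def Pi_def)

lemma mult_sym_product: "p \<otimes>\<^bsub>sym_product n\<^esub> q = (\<lambda>k. p k \<circ> q k)"
  by (simp add: sym_product_def sym_group_def restrict_def)

lemma one_sym_product: "\<one>\<^bsub>sym_product n\<^esub> = (\<lambda>k. id)"
  by (simp add: sym_product_def sym_group_def restrict_def)

lemma group_sym_product: "group (sym_product n)"
  unfolding sym_product_def
  by (rule product_group) (simp add: sym_group_is_group)

lemma inv_sym_product:
  assumes "p \<in> carrier (sym_product n)"
  shows "inv\<^bsub>sym_product n\<^esub> p = (\<lambda>k. Hilbert_Choice.inv (p k))"
proof (rule group.inv_equality[OF group_sym_product _ assms])
  show "(\<lambda>k. Hilbert_Choice.inv (p k)) \<otimes>\<^bsub>sym_product n\<^esub> p = \<one>\<^bsub>sym_product n\<^esub>"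
    using assms by (auto simp: mult_sym_product one_sym_product carrier_sym_product intro!: ext permutes_inverses(2))
  show "(\<lambda>k. Hilbert_Choice.inv (p k)) \<in> carrier (sym_product n)"
    using assms by (simp add: carrier_sym_product permutes_inv)
qed

lemma hamming_nonneg: "0 \<le> hamming n p q"
  by (simp add: hamming_def)

lemma hamming_mult_le: "p permutes {1..n} \<Longrightarrow> q permutes {1..n} \<Longrightarrow>
  hamming n (p \<circ> q) id \<le> hamming n p id + hamming n q id"
proof -
  assume p: "p permutes {1..n}" and q: "q permutes {1..n}"
  have "card {i \<in> {1..n}. (p \<circ> q) i \<noteq> id i}
      \<le> card ({i \<in> {1..n}. p i \<noteq> id i} \<union> {i \<in> {1..n}. q i \<noteq> id i})"
    by (rule card_mono) (use q in auto)
  also have "\<dots> \<le> card {i \<in> {1..n}. p i \<noteq> id i} + card {i \<in> {1..n}. q i \<noteq> id i}"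
    by (rule card_Un_le)
  finally show ?thesis
    unfolding hamming_def add_divide_distrib[symmetric]
    by (intro divide_right_mono) linarith+
qed

lemma hamming_inv: "p permutes {1..n} \<Longrightarrow>
  hamming n (Hilbert_Choice.inv p) id = hamming n p id"
proof -
  assume p: "p permutes {1..n}"
  have "{i \<in> {1..n}. Hilbert_Choice.inv p i \<noteq> id i} = {i \<in> {1..n}. p i \<noteq> id i}"
    by (intro Collect_cong conj_cong refl) (metis permutes_inv_eq[OF p] id_apply)
  then show ?thesis by (simp only: hamming_def)
qed

lemma hamming_conj: "p permutes {1..n} \<Longrightarrow>
  hamming n (p \<circ> h \<circ> Hilbert_Choice.inv p) id = hamming n h id"
proof -
  assume p: "p permutes {1..n}"
  have "{i \<in> {1..n}. (p \<circ> h \<circ> Hilbert_Choice.inv p) i \<noteq> id i} = p ` {i \<in> {1..n}. h i \<noteq> id i}"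
  proof (intro Set.set_eqI iffI)
    fix i assume "i \<in> {i \<in> {1..n}. (p \<circ> h \<circ> Hilbert_Choice.inv p) i \<noteq> id i}"
    then have "Hilbert_Choice.inv p i \<in> {i \<in> {1..n}. h i \<noteq> id i}" "i = p (Hilbert_Choice.inv p i)"
      using permutes_inverses[OF p] permutes_in_image[OF permutes_inv[OF p], of i] by auto
    then show "i \<in> p ` {i \<in> {1..n}. h i \<noteq> id i}" by blast
  next
    fix i assume "i \<in> p ` {i \<in> {1..n}. h i \<noteq> id i}"
    then show "i \<in> {i \<in> {1..n}. (p \<circ> h \<circ> Hilbert_Choice.inv p) i \<noteq> id i}"
      using permutes_inverses(2)[OF p] permutes_in_image[OF p] inj_eq[OF permutes_inj[OF p]] by auto
  qed
  moreover have "card (p ` {i \<in> {1..n}. h i \<noteq> id i}) = card {i \<in> {1..n}. h i \<noteq> id i}"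
    by (rule card_image) (use permutes_inj[OF p] in \<open>auto intro: inj_on_subset\<close>)
  ultimately show ?thesis by (simp only: hamming_def)
qed

lemma normal_null_sequences: "null_sequences \<omega> n \<lhd> sym_product n"
proof -
  interpret G: group "sym_product n" by (rule group_sym_product)
  have N: "p \<in> null_sequences \<omega> n \<longleftrightarrow>
      (\<forall>k. p k permutes {1..n k}) \<and> ((\<lambda>k. hamming (n k) (p k) id) \<longlongrightarrow> 0) \<omega>" for p
    by (simp add: null_sequences_def carrier_sym_product sym_group_one)
  have "subgroup (null_sequences \<omega> n) (sym_product n)"
  proof (rule G.subgroupI)
    show "null_sequences \<omega> n \<subseteq> carrier (sym_product n)"
      by (auto simp: null_sequences_def)
    have "(\<lambda>k. id) \<in> null_sequences \<omega> n"
      by (simp add: N hamming_def permutes_id)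
    then show "null_sequences \<omega> n \<noteq> {}" by auto
  next
    fix p assume "p \<in> null_sequences \<omega> n"
    then show "inv\<^bsub>sym_product n\<^esub> p \<in> null_sequences \<omega> n"
      by (simp add: N inv_sym_product carrier_sym_product permutes_inv hamming_inv)
  next
    fix p q assume pq: "p \<in> null_sequences \<omega> n" "q \<in> null_sequences \<omega> n"
    have p: "\<And>k. p k permutes {1..n k}" "((\<lambda>k. hamming (n k) (p k) id) \<longlongrightarrow> 0) \<omega>"
      and q: "\<And>k. q k permutes {1..n k}" "((\<lambda>k. hamming (n k) (q k) id) \<longlongrightarrow> 0) \<omega>"
      using pq by (simp_all only: N)
    have "norm (hamming (n k) (p k \<circ> q k) id)
        \<le> hamming (n k) (p k) id + hamming (n k) (q k) id" for k
      unfolding real_norm_def abs_of_nonneg[OF hamming_nonneg]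
      by (rule hamming_mult_le[OF p(1) q(1)])
    note this tendsto_add_zero[OF p(2) q(2)]
    then have "((\<lambda>k. hamming (n k) (p k \<circ> q k) id) \<longlongrightarrow> 0) \<omega>"
      by (rule Lim_null_comparison[OF always_eventually[OF allI]])
    moreover have "p k \<circ> q k permutes {1..n k}" for k
      by (rule permutes_compose[OF q(1) p(1)])
    ultimately show "p \<otimes>\<^bsub>sym_product n\<^esub> q \<in> null_sequences \<omega> n"
      unfolding N mult_sym_product by (intro conjI allI)
  qed
  moreover have "p \<otimes>\<^bsub>sym_product n\<^esub> h \<otimes>\<^bsub>sym_product n\<^esub> inv\<^bsub>sym_product n\<^esub> p
      \<in> null_sequences \<omega> n"
    if p: "p \<in> carrier (sym_product n)" and h: "h \<in> null_sequences \<omega> n" for p h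
  proof -
    have pk: "p k permutes {1..n k}" and hk: "h k permutes {1..n k}" for k
      using p h by (simp_all add: N carrier_sym_product)
    have "p k \<circ> h k \<circ> Hilbert_Choice.inv (p k) permutes {1..n k}" for k
      by (intro permutes_compose permutes_inv pk hk)
    moreover have "((\<lambda>k. hamming (n k) (p k \<circ> h k \<circ> Hilbert_Choice.inv (p k)) id) \<longlongrightarrow> 0) \<omega>"
      using h unfolding N hamming_conj[OF pk] by (rule conjunct2)
    ultimately show ?thesis
      unfolding N mult_sym_product inv_sym_product[OF p] by (intro conjI allI)
  qed
  ultimately show ?thesis
    unfolding G.normal_inv_iff by (intro conjI ballI)
qed

lemma group_universal_sofic_group: "group (universal_sofic_group \<omega> n)"
  unfolding universal_sofic_group_def
  by (rule normal.factorgroup_is_group[OF normal_null_sequences])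

lemma mem_orbit_self:
  fixes p :: "nat \<Rightarrow> nat"
  assumes "p permutes {1..n}"
  shows "x \<in> orbit p x"
  by (rule permutation_self_in_orbit, rule permutes_imp_permutation[OF _ assms]) simp

lemma orbit_permutes_subset:
  fixes p :: "nat \<Rightarrow> nat"
  assumes p: "p permutes {1..n}" and x: "x \<in> {1..n}"
  shows "orbit p x \<subseteq> {1..n}"
proof
  fix y assume "y \<in> orbit p x"
  then show "y \<in> {1..n}"
    by induction (simp_all only: permutes_in_image[OF p] x)
qed

lemma orbit_eq_permutes:
  fixes p :: "nat \<Rightarrow> nat"
  assumes p: "p permutes {1..n}" and x: "y \<in> orbit p x"
  shows "orbit p x = orbit p y"
proof -
  have "x \<in> orbit p y" by (rule orbit_swap[OF mem_orbit_self[OF p] x])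
  show ?thesis
  proof (intro subset_antisym subsetI)
    show "z \<in> orbit p y" if "z \<in> orbit p x" for z
      by (rule orbit_trans[OF that \<open>x \<in> orbit p y\<close>])
    show "z \<in> orbit p x" if "z \<in> orbit p y" for z
      by (rule orbit_trans[OF that x])
  qed
qed

lemma cyc_set_eq:
  assumes p: "p permutes {1..n}"
  shows "{x. \<exists>c \<in> perm_cycles n p. x \<in> c \<and> card c = i} = {x \<in> {1..n}. card (orbit p x) = i}"
  (is "?L = ?R")
proof (rule subset_antisym; rule subsetI)
  fix x assume "x \<in> ?L"
  then obtain y where y: "y \<in> {1..n}" "x \<in> orbit p y" "card (orbit p y) = i"
    unfolding perm_cycles_def by blast
  have "x \<in> {1..n}" using orbit_permutes_subset[OF p y(1)] y(2) by blast
  moreover have "card (orbit p x) = i" using orbit_eq_permutes[OF p y(2)] y(3) by simp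
  ultimately show "x \<in> ?R" by blast
next
  fix x assume "x \<in> ?R"
  then have "orbit p x \<in> perm_cycles n p" "card (orbit p x) = i"
    by (simp_all add: perm_cycles_def)
  then show "x \<in> ?L" using mem_orbit_self[OF p, of x] by blast
qed

lemma orbit_cong_on:
  fixes p q :: "nat \<Rightarrow> nat"
  assumes p: "p permutes {1..n}" and q: "q permutes {1..n}"
    and eq: "\<And>y. y \<in> orbit p x \<Longrightarrow> p y = q y"
  shows "orbit q x = orbit p x"
proof (intro Set.set_eqI iffI)
  fix y assume "y \<in> orbit q x"
  then show "y \<in> orbit p x"
  proof induction
    case base
    show ?case using eq[OF mem_orbit_self[OF p]] orbit.base[of p x] by simp
  next
    case (step y)
    then show ?case using eq[OF step.IH] orbit.step[OF step.IH] by simp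
  qed
next
  fix y assume "y \<in> orbit p x"
  then show "y \<in> orbit q x"
  proof induction
    case base
    show ?case using eq[OF mem_orbit_self[OF p]] orbit.base[of q x] by simp
  next
    case (step y)
    then show ?case using eq[OF step.hyps] orbit.step[OF step.IH] by simp
  qed
qed

lemma cyc_diff_le:
  assumes p: "p permutes {1..n}" and q: "q permutes {1..n}"
  shows "cyc i n p - cyc i n q \<le> real i * hamming n p q"
proof -
  let ?P = "{x \<in> {1..n}. card (orbit p x) = i}" and ?Q = "{x \<in> {1..n}. card (orbit q x) = i}"
  let ?D = "{y \<in> {1..n}. p y \<noteq> q y}"
  let ?E = "{y \<in> ?D. card (orbit p y) = i}"
  have sub: "?P - ?Q \<subseteq> (\<Union>y\<in>?E. orbit p y)"
  proof
    fix x assume x: "x \<in> ?P - ?Q"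
    then have "orbit q x \<noteq> orbit p x" by auto
    then obtain y where y: "y \<in> orbit p x" "p y \<noteq> q y" using orbit_cong_on[OF p q] by metis
    have o: "orbit p x = orbit p y" by (rule orbit_eq_permutes[OF p y(1)])
    have "y \<in> {1..n}" using orbit_permutes_subset[OF p, of x] x y(1) by blast
    moreover have "card (orbit p y) = i" using x o by simp
    ultimately have "y \<in> ?E" using y(2) by blast
    moreover have "x \<in> orbit p y" using mem_orbit_self[OF p, of x] o by simp
    ultimately show "x \<in> (\<Union>y\<in>?E. orbit p y)" by (rule UN_I)
  qed
  have "card (?P - ?Q) \<le> card (\<Union>y\<in>?E. orbit p y)"
    by (rule card_mono[OF _ sub])
       (auto intro: finite_subset[OF orbit_permutes_subset[OF p]])
  also have "\<dots> \<le> (\<Sum>y\<in>?E. card (orbit p y))" by (rule card_UN_le) auto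
  also have "\<dots> = i * card ?E" by simp
  also have "\<dots> \<le> i * card ?D" by (intro mult_left_mono card_mono) auto
  finally have PQ: "card (?P - ?Q) \<le> i * card ?D" .
  have "card ?P \<le> card (?Q \<union> (?P - ?Q))" by (rule card_mono) auto
  also have "\<dots> \<le> card ?Q + card (?P - ?Q)" by (rule card_Un_le)
  also have "\<dots> \<le> card ?Q + i * card ?D" by (rule add_left_mono[OF PQ])
  finally have "real (card ?P) \<le> real (card ?Q + i * card ?D)" by (rule of_nat_mono)
  then have "real (card ?P) \<le> real (card ?Q) + real i * real (card ?D)"
    by (simp only: of_nat_add of_nat_mult)
  then have "real (card ?P) / real n \<le> (real (card ?Q) + real i * real (card ?D)) / real n"
    by (rule divide_right_mono) simp
  then show ?thesis
    unfolding cyc_def cyc_set_eq[OF p] cyc_set_eq[OF q] hamming_def add_divide_distrib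
    by (simp only: diff_le_eq times_divide_eq_right add.commute)
qed

lemma hamming_commute: "hamming n p q = hamming n q p"
proof -
  have "{i \<in> {1..n}. p i \<noteq> q i} = {i \<in> {1..n}. q i \<noteq> p i}" by auto
  then show ?thesis by (simp only: hamming_def)
qed

lemma cyc_nonneg: "0 \<le> cyc i n p"
  by (simp add: cyc_def)

lemma sum_cyc_le_1:
  assumes p: "p permutes {1..n}" and "finite I"
  shows "(\<Sum>i\<in>I. cyc i n p) \<le> 1"
proof -
  have "(\<Sum>i\<in>I. card {x \<in> {1..n}. card (orbit p x) = i})
      = card (\<Union>i\<in>I. {x \<in> {1..n}. card (orbit p x) = i})"
    by (rule card_UN_disjoint[symmetric]) (use assms in auto)
  also have "\<dots> \<le> card {1..n}" by (rule card_mono) auto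
  finally have "(\<Sum>i\<in>I. card {x \<in> {1..n}. card (orbit p x) = i}) \<le> n" by simp
  then have "(\<Sum>i\<in>I. real (card {x \<in> {1..n}. card (orbit p x) = i})) \<le> real n"
    by (metis of_nat_le_iff of_nat_sum)
  then have "(\<Sum>i\<in>I. real (card {x \<in> {1..n}. card (orbit p x) = i})) / real n \<le> 1"
    by (cases "n = 0") (simp_all add: divide_le_eq_1)
  then show ?thesis
    by (simp only: cyc_def cyc_set_eq[OF p] sum_divide_distrib)
qed

lemma ultrafilter_tendsto_ex:
  fixes f :: "'a \<Rightarrow> 'b :: t2_space"
  assumes \<omega>: "ultrafilter \<omega>" and K: "compact K" and f: "\<And>k. f k \<in> K"
  shows "\<exists>l\<in>K. (f \<longlongrightarrow> l) \<omega>"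
proof -
  have "filtermap f \<omega> \<noteq> bot" using \<omega> by (simp add: ultrafilter_def filtermap_bot_iff)
  moreover have "eventually (\<lambda>x. x \<in> K) (filtermap f \<omega>)" by (simp add: eventually_filtermap f)
  ultimately obtain l where l: "l \<in> K" "inf (nhds l) (filtermap f \<omega>) \<noteq> bot"
    using K unfolding compact_filter by blast
  have "(f \<longlongrightarrow> l) \<omega>"
  proof (rule topological_tendstoI, rule ccontr)
    fix S assume S: "open S" "l \<in> S" "\<not> eventually (\<lambda>k. f k \<in> S) \<omega>"
    then have "eventually (\<lambda>x. x \<notin> S) (filtermap f \<omega>)"
      using \<omega> by (auto simp: ultrafilter_def eventually_filtermap)
    moreover have "eventually (\<lambda>x. x \<in> S) (nhds l)" using S by (simp add: eventually_nhds_in_open)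
    ultimately have "eventually (\<lambda>x. False) (inf (nhds l) (filtermap f \<omega>))"
      unfolding eventually_inf by blast
    then show False using l by (simp add: trivial_limit_def)
  qed
  with l show ?thesis by blast
qed

lemma sofic_class_iff:
  assumes "p \<in> carrier (sym_product n)"
  shows "q \<in> sofic_class \<omega> n p \<longleftrightarrow>
    q \<in> carrier (sym_product n) \<and> ((\<lambda>k. hamming (n k) (p k) (q k)) \<longlongrightarrow> 0) \<omega>"
proof -
  have *: "hamming m (h \<circ> r) r = hamming m h id"
    if r: "r permutes {1..m}" for m and h r :: "nat \<Rightarrow> nat"
  proof -
    have "{i \<in> {1..m}. h i \<noteq> id i} = r ` {i \<in> {1..m}. (h \<circ> r) i \<noteq> r i}"
    proof (rule subset_antisym; rule subsetI)
      fix i assume i: "i \<in> {i \<in> {1..m}. h i \<noteq> id i}"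
      then obtain j where "j \<in> {1..m}" "i = r j" using permutes_image[OF r] by blast
      with i show "i \<in> r ` {i \<in> {1..m}. (h \<circ> r) i \<noteq> r i}" by auto
    next
      fix i assume "i \<in> r ` {i \<in> {1..m}. (h \<circ> r) i \<noteq> r i}"
      then obtain j where "j \<in> {1..m}" "i = r j" "h (r j) \<noteq> r j" by auto
      then show "i \<in> {i \<in> {1..m}. h i \<noteq> id i}" using permutes_in_image[OF r, of j] by simp
    qed
    moreover have "card (r ` {i \<in> {1..m}. (h \<circ> r) i \<noteq> r i}) = card {i \<in> {1..m}. (h \<circ> r) i \<noteq> r i}"
      by (rule card_image) (use permutes_inj[OF r] in \<open>auto intro: inj_on_subset\<close>)
    ultimately show ?thesis by (simp only: hamming_def)
  qed
  have per: "r k permutes {1..n k}" if "r \<in> carrier (sym_product n)" for r k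
    using that by (simp add: carrier_sym_product)
  note p = per[OF assms]
  have mem: "q \<in> sofic_class \<omega> n p \<longleftrightarrow> (\<exists>h\<in>null_sequences \<omega> n. q = (\<lambda>k. h k \<circ> p k))"
    by (auto simp: sofic_class_def r_coset_def mult_sym_product)
  show ?thesis
  proof
    assume "q \<in> sofic_class \<omega> n p"
    then obtain h where h: "h \<in> null_sequences \<omega> n" "q = (\<lambda>k. h k \<circ> p k)" using mem by blast
    have hk: "((\<lambda>k. hamming (n k) (h k) id) \<longlongrightarrow> 0) \<omega>" "h \<in> carrier (sym_product n)"
      using h(1) by (simp_all add: null_sequences_def sym_group_one)
    have "hamming (n k) (p k) (h k \<circ> p k) = hamming (n k) (h k) id" for k
      by (subst hamming_commute, rule *[OF p])
    with hk(1) have "((\<lambda>k. hamming (n k) (p k) (h k \<circ> p k)) \<longlongrightarrow> 0) \<omega>" by (simp only:)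
    moreover have "(\<lambda>k. h k \<circ> p k) \<in> carrier (sym_product n)"
      unfolding carrier_sym_product by (intro allI permutes_compose[OF p per[OF hk(2)]])
    ultimately show "q \<in> carrier (sym_product n) \<and> ((\<lambda>k. hamming (n k) (p k) (q k)) \<longlongrightarrow> 0) \<omega>"
      unfolding h(2) by (intro conjI)
  next
    assume q: "q \<in> carrier (sym_product n) \<and> ((\<lambda>k. hamming (n k) (p k) (q k)) \<longlongrightarrow> 0) \<omega>"
    define h where "h = (\<lambda>k. q k \<circ> Hilbert_Choice.inv (p k))"
    have qk: "q k = h k \<circ> p k" for k
      unfolding h_def comp_assoc permutes_inv_o(2)[OF p] comp_id ..
    have qh: "q = (\<lambda>k. h k \<circ> p k)" by (rule ext) (rule qk)
    have "hamming (n k) (p k) (q k) = hamming (n k) (h k) id" for k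
      by (subst hamming_commute, subst qk, rule *[OF p])
    with conjunct2[OF q] have "((\<lambda>k. hamming (n k) (h k) id) \<longlongrightarrow> 0) \<omega>" by (simp only:)
    moreover have "h k permutes {1..n k}" for k
      unfolding h_def
      by (rule permutes_compose[OF permutes_inv[OF p] per[OF conjunct1[OF q]]])
    ultimately have "h \<in> null_sequences \<omega> n"
      by (simp add: null_sequences_def carrier_sym_product sym_group_one)
    with qh show "q \<in> sofic_class \<omega> n p" unfolding mem by (rule bexI)
  qed
qed

lemma sofic_cyc_tendsto:
  assumes \<omega>: "ultrafilter \<omega>" and p: "p \<in> carrier (sym_product n)"
  shows "((\<lambda>k. cyc i (n k) (p k)) \<longlongrightarrow> sofic_cyc \<omega> n i (sofic_class \<omega> n p)) \<omega>"
proof -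
  have per: "r k permutes {1..n k}" if "r \<in> carrier (sym_product n)" for r k
    using that by (simp add: carrier_sym_product)
  have "cyc i (n k) (p k) \<in> {0..1}" for k
    using sum_cyc_le_1[OF per[OF p], of "{i}" k] by (simp add: cyc_nonneg)
  from ultrafilter_tendsto_ex[OF \<omega> compact_Icc this]
  obtain l where l: "((\<lambda>k. cyc i (n k) (p k)) \<longlongrightarrow> l) \<omega>" by (rule bexE)
  have all: "((\<lambda>k. cyc i (n k) (q k)) \<longlongrightarrow> l) \<omega>" if "q \<in> sofic_class \<omega> n p" for q
  proof -
    have q: "q \<in> carrier (sym_product n)" "((\<lambda>k. hamming (n k) (p k) (q k)) \<longlongrightarrow> 0) \<omega>"
      using that unfolding sofic_class_iff[OF p] by (rule conjunct1, rule conjunct2)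
    have "\<bar>cyc i (n k) (q k) - cyc i (n k) (p k)\<bar> \<le> real i * hamming (n k) (p k) (q k)" for k
      using cyc_diff_le[OF per[OF p] per[OF q(1)], of i k]
        cyc_diff_le[OF per[OF q(1)] per[OF p], of i k] hamming_commute[of "n k" "q k" "p k"]
      by (simp only: abs_le_iff minus_diff_eq simp_thms)
    then have "((\<lambda>k. cyc i (n k) (q k) - cyc i (n k) (p k)) \<longlongrightarrow> 0) \<omega>"
      by (intro Lim_null_comparison[OF _ tendsto_mult_right_zero[OF q(2), of "real i"]])
         (simp only: real_norm_def eventually_True)
    from tendsto_add[OF this l] show ?thesis by (simp only: diff_add_cancel add_0)
  qed
  have self: "p \<in> sofic_class \<omega> n p"
    using p unfolding sofic_class_iff[OF p] by (simp add: hamming_def)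
  have nb: "\<omega> \<noteq> bot" using \<omega> by (simp add: ultrafilter_def)
  have eq: "sofic_cyc \<omega> n i (sofic_class \<omega> n p) = l"
    unfolding sofic_cyc_def
  proof (rule the_equality)
    show "\<forall>q\<in>sofic_class \<omega> n p. ((\<lambda>k. cyc i (n k) (q k)) \<longlongrightarrow> l) \<omega>"
      by (rule ballI) (rule all)
    show "l' = l"
      if "\<forall>q\<in>sofic_class \<omega> n p. ((\<lambda>k. cyc i (n k) (q k)) \<longlongrightarrow> l') \<omega>" for l'
      by (rule tendsto_unique[OF nb bspec[OF that self] l])
  qed
  show ?thesis unfolding eq by (rule l)
qed

lemma summable_sofic_cyc:
  assumes \<omega>: "ultrafilter \<omega>" and p: "p \<in> carrier (sym_product n)"
  shows "summable (\<lambda>i. sofic_cyc \<omega> n (Suc i) (sofic_class \<omega> n p))"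
    and "0 \<le> sofic_cyc_inf \<omega> n (sofic_class \<omega> n p)"
proof -
  let ?c = "\<lambda>i. sofic_cyc \<omega> n (Suc i) (sofic_class \<omega> n p)"
  have nb: "\<omega> \<noteq> bot" using \<omega> by (simp add: ultrafilter_def)
  have pos: "0 \<le> ?c i" for i
    by (rule tendsto_lowerbound[OF sofic_cyc_tendsto[OF \<omega> p] _ nb]) (simp add: cyc_nonneg)
  have le: "(\<Sum>i<m. ?c i) \<le> 1" for m
  proof (rule tendsto_upperbound[OF _ _ nb])
    show "((\<lambda>k. \<Sum>i<m. cyc (Suc i) (n k) (p k)) \<longlongrightarrow> (\<Sum>i<m. ?c i)) \<omega>"
      by (intro tendsto_sum sofic_cyc_tendsto \<omega> p)
    have "(\<Sum>i<m. cyc (Suc i) (n k) (p k)) \<le> 1" for k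
    proof -
      have "(\<Sum>i<m. cyc (Suc i) (n k) (p k)) = (\<Sum>i\<in>Suc ` {..<m}. cyc i (n k) (p k))"
        by (subst sum.reindex) auto
      also have "\<dots> \<le> 1" using p by (intro sum_cyc_le_1) (auto simp: carrier_sym_product)
      finally show ?thesis .
    qed
    then show "\<forall>\<^sub>F k in \<omega>. (\<Sum>i<m. cyc (Suc i) (n k) (p k)) \<le> 1" by simp
  qed
  show s: "summable ?c"
    by (rule summableI_nonneg_bounded[OF pos le])
  show "0 \<le> sofic_cyc_inf \<omega> n (sofic_class \<omega> n p)"
    using suminf_le_const[OF s le] by (simp add: sofic_cyc_inf_def)
qed

end

theory Submission
  imports Defs
begin

text \<open>
  Through representatives, stability of the centralizer says: whenever permutations \<open>q k\<close>
  commute with \<open>p k\<close> up to a vanishing proportion of points, they can be changed on a vanishing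
  proportion of points so as to commute with \<open>p k\<close> exactly (\<open>stable_centralizer_iff\<close>). The
  number \<open>sofic_cyc_inf\<close> is the limit over \<open>m\<close> of the proportion of points lying, along
  \<open>\<omega>\<close>, on cycles longer than \<open>m\<close>.

  Suppose that this limit is \<open>0\<close>. Call \<open>x\<close> bad if \<open>p (q x) \<noteq> q (p x)\<close>. On the cycles without
  bad points \<open>q\<close> is equivariant, so it sends them injectively to cycles of the same length; by
  counting, as many cycles of each length remain in the source as in the target, and matching them
  gives a permutation that commutes with \<open>p\<close> and agrees with \<open>q\<close> off the cycles containing bad
  points (\<open>extend_equivariant\<close>). A bad point spoils at most \<open>m\<close> points if its cycle has length at
  most \<open>m\<close>, and the longer cycles are negligible for large \<open>m\<close>
  (\<open>approximate_by_commuting\<close>).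

  Suppose conversely that the limit is \<open>c > 0\<close>. As \<open>\<omega>\<close> is nonprincipal, a diagonal choice
  (\<open>nonprincipal_diagonal\<close>) gives \<open>m k\<close> tending to infinity such that cycles longer than \<open>m k\<close>
  still carry a proportion \<open>c / 2\<close> of the points. On each of these let \<open>q k\<close> rotate the first half
  of the cycle and fix the second half, and let it fix all other points. It fails to commute with
  \<open>p k\<close> at no more than three points of each long cycle, hence at a proportion at most \<open>3 / m k\<close>
  (\<open>card_noncommuting_half_rotation\<close>). But a permutation commuting with \<open>p k\<close> fixes all points of
  a cycle or none, so it differs from \<open>q k\<close> on roughly half of every long cycle, at any rate on a third
  (\<open>half_rotation_far_from_commuting\<close>).
\<close>

section \<open>Cycle coordinates\<close>

locale finite_permutation =
  fixes S :: "'a set" and p :: "'a \<Rightarrow> 'a"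
  assumes finite_S: "finite S" and permutes: "p permutes S"
begin

lemma permutation: "permutation p"
  using finite_S permutes permutation_permutes by blast

lemma self_in_orbit: "x \<in> orbit p x"
  by (rule permutation_self_in_orbit[OF permutation])

lemma orbit_eq_if_mem: "y \<in> orbit p x \<Longrightarrow> orbit p y = orbit p x"
  using cyclic_on_orbit'[OF permutation, of x] by (rule orbit_cyclic_eq3)

lemma mem_orbit_iff: "y \<in> orbit p x \<longleftrightarrow> (\<exists>j. y = (p ^^ j) x)"
  using orbit_altdef_permutation[OF permutation, of x] by auto

lemma orbit_funpow: "orbit p ((p ^^ j) x) = orbit p x"
  by (rule orbit_eq_if_mem) (auto simp: mem_orbit_iff)

lemma orbit_step_eq: "orbit p (p x) = orbit p x"
  by (rule permutation_orbit_step[OF permutation])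

lemma orbit_subset_S: "x \<in> S \<Longrightarrow> orbit p x \<subseteq> S"
  by (rule permutes_orbit_subset[OF permutes])

lemma funpow_in_S_iff: "(p ^^ j) x \<in> S \<longleftrightarrow> x \<in> S"
  by (induction j) (simp_all add: permutes_in_image[OF permutes])

lemma funpow_card_orbit: "(p ^^ card (orbit p x)) x = x"
  and card_orbit_pos: "0 < card (orbit p x)"
  and inj_on_funpow_orbit: "inj_on (\<lambda>j. (p ^^ j) x) {..<card (orbit p x)}"
proof -
  note inj = inj_on_funpow_dist1[OF self_in_orbit[of x]]
  have "card (orbit p x) = funpow_dist1 p x x"
    using card_image[OF inj] orbit_conv_funpow_dist1[OF self_in_orbit[of x]] by simp
  then show "(p ^^ card (orbit p x)) x = x" "0 < card (orbit p x)"
    "inj_on (\<lambda>j. (p ^^ j) x) {..<card (orbit p x)}"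
    using funpow_dist1_prop[OF self_in_orbit[of x]] inj
    by (simp_all only: lessThan_atLeast0 zero_less_Suc)
qed

lemma funpow_mod_card_orbit: "(p ^^ (j mod card (orbit p x))) x = (p ^^ j) x"
  by (rule funpow_mod_eq[OF funpow_card_orbit])

lemma funpow_eq_iff:
  "(p ^^ i) x = (p ^^ j) x \<longleftrightarrow> i mod card (orbit p x) = j mod card (orbit p x)"
  using inj_on_eq_iff[OF inj_on_funpow_orbit[of x],
      of "i mod card (orbit p x)" "j mod card (orbit p x)"]
  by (simp add: card_orbit_pos funpow_mod_card_orbit)

text \<open>A base point on every cycle; a point is then determined by the base point of its cycle and
  by its position, the number of steps from there.\<close>
definition rep :: "'a \<Rightarrow> 'a" where
  "rep x = (SOME y. y \<in> orbit p x)"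

definition pos :: "'a \<Rightarrow> nat" where
  "pos x = funpow_dist p (rep x) x"

lemma rep_in_orbit: "rep x \<in> orbit p x"
  unfolding rep_def by (rule someI[of _ x]) (rule self_in_orbit)

lemma orbit_rep: "orbit p (rep x) = orbit p x"
  by (rule orbit_eq_if_mem[OF rep_in_orbit])

lemma rep_eq_iff: "rep x = rep y \<longleftrightarrow> orbit p x = orbit p y"
  by (metis orbit_rep rep_def)

lemma rep_in_S: "x \<in> S \<Longrightarrow> rep x \<in> S"
  using rep_in_orbit orbit_subset_S by blast

lemma funpow_pos: "(p ^^ pos x) (rep x) = x"
  unfolding pos_def by (rule funpow_dist_prop) (simp only: orbit_rep self_in_orbit)

lemma pos_less: "pos x < card (orbit p x)"
proof -
  have "pos x \<le> pos x mod card (orbit p x)"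
    unfolding pos_def funpow_dist_def
    by (rule Least_le)
      (metis funpow_dist_def funpow_mod_card_orbit funpow_pos orbit_rep pos_def)
  then show ?thesis
    using card_orbit_pos[of x] mod_less_divisor order.strict_trans1 by blast
qed

lemma rep_funpow: "rep ((p ^^ j) x) = rep x"
  by (simp only: rep_eq_iff orbit_funpow)

lemma rep_rep: "rep (rep x) = rep x"
  by (simp only: rep_eq_iff orbit_rep)

lemma pos_funpow_rep:
  assumes "j < card (orbit p x)"
  shows "pos ((p ^^ j) (rep x)) = j"
proof -
  let ?y = "(p ^^ j) (rep x)"
  have "(p ^^ pos ?y) (rep x) = (p ^^ j) (rep x)"
    using funpow_pos[of ?y] by (simp only: rep_funpow rep_rep)
  moreover have "pos ?y < card (orbit p x)"
    using pos_less[of ?y] by (simp only: orbit_funpow orbit_rep)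
  ultimately show ?thesis
    using assms unfolding funpow_eq_iff orbit_rep by simp
qed

lemma pos_funpow: "pos ((p ^^ j) x) = (pos x + j) mod card (orbit p x)"
proof -
  have "(p ^^ j) x = (p ^^ (j + pos x)) (rep x)"
    by (simp only: funpow_add comp_apply funpow_pos)
  also have "\<dots> = (p ^^ ((pos x + j) mod card (orbit p x))) (rep x)"
    unfolding funpow_eq_iff orbit_rep by (simp add: add.commute)
  finally show ?thesis
    using pos_funpow_rep[of "(pos x + j) mod card (orbit p x)" x] card_orbit_pos[of x] by simp
qed

section \<open>Completing partial equivariant maps\<close>

text \<open>A partial equivariant injection extends to one more cycle: \<open>f\<close> preserves cycle lengths, so
  the points on cycles of the length of that of \<open>a\<close> cannot all be values of \<open>f\<close> as long as \<open>a\<close>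
  itself is outside the domain. Any point \<open>b\<close> that is missed can serve as the image of \<open>a\<close>,
  because two cycles of equal length are isomorphic.\<close>
lemma extend_equivariant_orbit:
  assumes T: "T \<subseteq> S" "p ` T \<subseteq> T" and f: "inj_on f T" "f ` T \<subseteq> S"
    and eqv: "\<And>x. x \<in> T \<Longrightarrow> f (p x) = p (f x)"
    and a: "a \<in> S" "a \<notin> T"
  shows "\<exists>g. inj_on g (T \<union> orbit p a) \<and> g ` (T \<union> orbit p a) \<subseteq> S \<and>
           (\<forall>x\<in>T \<union> orbit p a. g (p x) = p (g x)) \<and> (\<forall>x\<in>T. g x = f x)"
proof -
  have fpow: "(p ^^ j) x \<in> T \<and> f ((p ^^ j) x) = (p ^^ j) (f x)" if "x \<in> T" for x j
    using that T(2) by (induction j) (auto simp: eqv)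
  have orbT: "orbit p x \<subseteq> T" if "x \<in> T" for x
    using fpow[OF that] by (auto simp: mem_orbit_iff)
  have disj: "orbit p a \<inter> T = {}"
    using orbT orbit_eq_if_mem self_in_orbit a(2) by blast
  have card_f: "card (orbit p (f x)) = card (orbit p x)" if x: "x \<in> T" for x
  proof -
    have "orbit p (f x) = f ` orbit p x"
    proof (intro Set.set_eqI iffI)
      fix y assume "y \<in> orbit p (f x)"
      then obtain j where "y = f ((p ^^ j) x)" using fpow[OF x] by (auto simp: mem_orbit_iff)
      then show "y \<in> f ` orbit p x" using mem_orbit_iff by blast
    next
      fix y assume "y \<in> f ` orbit p x"
      then obtain j where "y = (p ^^ j) (f x)" using fpow[OF x] by (auto simp: mem_orbit_iff)
      then show "y \<in> orbit p (f x)" by (auto simp: mem_orbit_iff)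
    qed
    then show ?thesis
      using card_image[OF inj_on_subset[OF f(1) orbT[OF x]]] by simp
  qed
  let ?l = "card (orbit p a)"
  let ?X = "{x \<in> S. card (orbit p x) = ?l}"
  have "f ` (T \<inter> ?X) \<subset> ?X"
  proof -
    have "card (f ` (T \<inter> ?X)) \<le> card (T \<inter> ?X)"
      by (rule card_image_le) (use finite_S in simp)
    also have "\<dots> < card ?X"
      by (rule psubset_card_mono) (use finite_S a in auto)
    finally have "f ` (T \<inter> ?X) \<noteq> ?X" by auto
    moreover have "f ` (T \<inter> ?X) \<subseteq> ?X" using card_f f(2) by auto
    ultimately show ?thesis by blast
  qed
  then obtain b where b: "b \<in> S" "card (orbit p b) = ?l" "b \<notin> f ` (T \<inter> ?X)" by blast
  have bT: "b \<notin> f ` T"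
    using b T(1) card_f by auto
  \<comment> \<open>The range of \<open>f\<close> is a union of cycles, so it misses the whole cycle of \<open>b\<close>.\<close>
  have orbb: "orbit p b \<inter> f ` T = {}"
  proof (rule equals0I)
    fix y assume "y \<in> orbit p b \<inter> f ` T"
    then obtain x where x: "x \<in> T" "f x \<in> orbit p b" by auto
    then have "b \<in> orbit p (f x)" using orbit_eq_if_mem self_in_orbit by blast
    then show False using bT fpow[OF x(1)] by (auto simp: mem_orbit_iff) (metis image_eqI)
  qed
  \<comment> \<open>Equality of the lengths makes \<open>p ^^ j a \<mapsto> p ^^ j b\<close> well defined and injective.\<close>
  have well: "(p ^^ i) a = (p ^^ j) a \<longleftrightarrow> (p ^^ i) b = (p ^^ j) b" for i j
    by (simp only: funpow_eq_iff b(2))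
  define g where "g x = (if x \<in> T then f x else (p ^^ (SOME j. (p ^^ j) a = x)) b)" for x
  have g_a: "g ((p ^^ j) a) = (p ^^ j) b" for j
  proof -
    have "(p ^^ j) a \<notin> T" using disj mem_orbit_iff by blast
    moreover have "(p ^^ (SOME i. (p ^^ i) a = (p ^^ j) a)) a = (p ^^ j) a"
      by (rule someI[of _ j]) simp
    ultimately show ?thesis by (simp add: g_def well)
  qed
  have g_orb: "g ` orbit p a = orbit p b"
    using orbit_altdef_permutation[OF permutation] g_a
    by (simp add: full_SetCompr_eq image_image)
  have g_T: "g x = f x" if "x \<in> T" for x using that by (simp add: g_def)
  have "inj_on g (orbit p a)"
    by (auto simp: inj_on_def mem_orbit_iff g_a well)
  moreover have "inj_on g T" using f(1) g_T by (simp cong: inj_on_cong)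
  moreover have "g ` T = f ` T" using g_T by simp
  ultimately have "inj_on g (T \<union> orbit p a)"
    using g_orb orbb unfolding inj_on_Un by blast
  moreover have "g ` (T \<union> orbit p a) \<subseteq> S"
    using g_orb orbit_subset_S[OF b(1)] \<open>g ` T = f ` T\<close> f(2) by (simp add: image_Un)
  moreover have "g (p x) = p (g x)" if x: "x \<in> T \<union> orbit p a" for x
  proof (cases "x \<in> T")
    case True
    then show ?thesis using T(2) by (auto simp: g_T eqv)
  next
    case False
    then obtain j where "x = (p ^^ j) a" using x by (auto simp: mem_orbit_iff)
    then show ?thesis using g_a[of "Suc j"] by (simp add: g_a)
  qed
  ultimately show ?thesis using g_T by blast
qed

lemma extend_equivariant:
  assumes "T \<subseteq> S" "p ` T \<subseteq> T" "inj_on f T" "f ` T \<subseteq> S"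
    and "\<And>x. x \<in> T \<Longrightarrow> f (p x) = p (f x)"
  shows "\<exists>g. g permutes S \<and> p \<circ> g = g \<circ> p \<and> (\<forall>x\<in>T. g x = f x)"
  using assms
proof (induction "card (S - T)" arbitrary: T f rule: less_induct)
  case less
  show ?case
  proof (cases "T = S")
    case True
    let ?g = "perm_restrict f S"
    have "?g permutes S"
    proof (rule bij_imp_permutes)
      have "inj_on ?g S" "?g ` S \<subseteq> S"
        using less.prems(3,4) unfolding True by (auto simp: perm_restrict_def inj_on_def)
      then show "bij_betw ?g S S"
        using finite_S by (simp add: bij_betw_def endo_inj_surj)
    qed (simp add: perm_restrict_def)
    moreover have "p \<circ> ?g = ?g \<circ> p"
      using less.prems(5) unfolding True
      by (auto simp: perm_restrict_def fun_eq_iff permutes_in_image[OF permutes]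
          permutes_not_in[OF permutes])
    ultimately show ?thesis by (auto simp: True perm_restrict_def)
  next
    case False
    then obtain a where a: "a \<in> S" "a \<notin> T" using less.prems(1) by blast
    obtain g where g: "inj_on g (T \<union> orbit p a)" "g ` (T \<union> orbit p a) \<subseteq> S"
      "\<And>x. x \<in> T \<union> orbit p a \<Longrightarrow> g (p x) = p (g x)" "\<forall>x\<in>T. g x = f x"
      using extend_equivariant_orbit[OF less.prems a] by metis
    have "card (S - (T \<union> orbit p a)) < card (S - T)"
      by (rule psubset_card_mono) (use finite_S a self_in_orbit[of a] in auto)
    moreover have "T \<union> orbit p a \<subseteq> S" using less.prems(1) orbit_subset_S[OF a(1)] by blast
    moreover have "p ` (T \<union> orbit p a) \<subseteq> T \<union> orbit p a"
      using less.prems(2) by (auto intro: orbit.step)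
    ultimately obtain g' where "g' permutes S" "p \<circ> g' = g' \<circ> p"
      "\<forall>x\<in>T \<union> orbit p a. g' x = g x"
      using less.hyps[of "T \<union> orbit p a" g] g by blast
    then show ?thesis using g(4) by auto
  qed
qed

text \<open>The commuting permutation is found independently of \<open>m\<close>, so that in a limit the bound can be
  used for every fixed \<open>m\<close>.\<close>
lemma approximate_by_commuting:
  assumes q: "q permutes S"
  shows "\<exists>g. g permutes S \<and> p \<circ> g = g \<circ> p \<and>
    (\<forall>m. card {x \<in> S. q x \<noteq> g x} \<le>
      card {x \<in> S. m < card (orbit p x)} + m * card {x \<in> S. p (q x) \<noteq> q (p x)})"
proof -
  let ?B = "{x \<in> S. p (q x) \<noteq> q (p x)}"
  \<comment> \<open>the cycles on which \<open>q\<close> is already equivariant\<close>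
  define T where "T = {x \<in> S. orbit p x \<inter> ?B = {}}"
  have "p ` T \<subseteq> T"
    by (auto simp: T_def orbit_step_eq permutes_in_image[OF permutes])
  moreover have "q (p x) = p (q x)" if "x \<in> T" for x
    using that self_in_orbit[of x] by (auto simp: T_def)
  moreover have "inj_on q T" "q ` T \<subseteq> S"
    using permutes_inj_on[OF q] permutes_in_image[OF q] by (auto simp: T_def)
  moreover have "T \<subseteq> S" by (auto simp: T_def)
  ultimately obtain g where g: "g permutes S" "p \<circ> g = g \<circ> p" "\<forall>x\<in>T. g x = q x"
    using extend_equivariant[of T q] by blast
  have "card {x \<in> S. q x \<noteq> g x} \<le> card {x \<in> S. m < card (orbit p x)} + m * card ?B" for m
  proof -
    let ?L = "{x \<in> S. m < card (orbit p x)}"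
    let ?C = "{y \<in> ?B. card (orbit p y) \<le> m}"
    have sub: "{x \<in> S. q x \<noteq> g x} \<subseteq> ?L \<union> (\<Union>y\<in>?C. orbit p y)"
    proof
      fix x assume x: "x \<in> {x \<in> S. q x \<noteq> g x}"
      then have "x \<notin> T" using g(3) by auto
      then obtain y where y: "y \<in> orbit p x" "y \<in> ?B" using x by (auto simp: T_def)
      have eq: "orbit p y = orbit p x" by (rule orbit_eq_if_mem[OF y(1)])
      then have "x \<in> orbit p y" using self_in_orbit[of x] by simp
      then show "x \<in> ?L \<union> (\<Union>y\<in>?C. orbit p y)"
        using x y(2) eq by (cases "m < card (orbit p x)") auto
    qed
    have fin: "finite (\<Union>y\<in>?C. orbit p y)"
      using finite_S finite_orbit[OF self_in_orbit] by auto
    have "card {x \<in> S. q x \<noteq> g x} \<le> card (?L \<union> (\<Union>y\<in>?C. orbit p y))"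
      by (rule card_mono[OF _ sub]) (use fin finite_S in simp)
    also have "\<dots> \<le> card ?L + card (\<Union>y\<in>?C. orbit p y)" by (rule card_Un_le)
    also have "card (\<Union>y\<in>?C. orbit p y) \<le> (\<Sum>y\<in>?C. card (orbit p y))"
      by (rule card_UN_le) (use finite_S in simp)
    also have "\<dots> \<le> card ?C * m"
      using sum_bounded_above[of ?C "\<lambda>y. card (orbit p y)" m] by simp
    also have "\<dots> \<le> m * card ?B"
      using finite_S by (auto intro!: card_mono simp: mult.commute)
    finally show ?thesis by simp
  qed
  with g show ?thesis by blast
qed

end

section \<open>Rotating half of each long cycle\<close>

text \<open>The rotation of an initial arc of length \<open>h\<close>, acting on positions: the permutation
  \<open>0 \<mapsto> 1 \<mapsto> \<dots> \<mapsto> h - 1 \<mapsto> 0\<close> extended by the identity.\<close>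
definition rotate_arc :: "nat \<Rightarrow> nat \<Rightarrow> nat" where
  "rotate_arc h j = (if Suc j < h then Suc j else if Suc j = h then 0 else j)"

lemma rotate_arc_less: "j < l \<Longrightarrow> h \<le> l \<Longrightarrow> rotate_arc h j < l"
  by (auto simp: rotate_arc_def)

lemma rotate_arc_inject: "rotate_arc h i = rotate_arc h j \<longleftrightarrow> i = j"
  by (auto simp: rotate_arc_def split: if_splits)

text \<open>The positions of a cycle of length \<open>l\<close> fall into the initial arc \<open>{..<l div 2}\<close> and its
  complement. A shift by \<open>l div 2\<close> exchanges the two, except that for odd \<open>l\<close> the complement has
  one position too many: \<open>l div 2\<close> moves to \<open>l - 1\<close>. A second shift repairs this one case.\<close>
lemma half_shifts_meet_both_halves:
  fixes i l :: nat
  assumes "i < l" and "2 \<le> l"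
  shows "\<not> ((l div 2 \<le> i \<longleftrightarrow> l div 2 \<le> (i + l div 2) mod l) \<and>
    (l div 2 \<le> i \<longleftrightarrow> l div 2 \<le> ((i + l div 2) mod l + l div 2) mod l))"
proof -
  define h where "h = l div 2"
  have l: "l = 2 * h \<or> l = 2 * h + 1" and h: "1 \<le> h"
    using assms(2) unfolding h_def by presburger+
  consider "i < h" | "h \<le> i" "l \<le> i + h" | "i = h" "l = 2 * h + 1"
    using l assms(1) by linarith
  then show ?thesis
    unfolding h_def[symmetric]
  proof cases
    case 1
    then have "(i + h) mod l = i + h" using l by auto
    with 1 show "\<not> ((h \<le> i \<longleftrightarrow> h \<le> (i + h) mod l) \<and> (h \<le> i \<longleftrightarrow> h \<le> ((i + h) mod l + h) mod l))"
      by simp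
  next
    case 2
    then have "(i + h) mod l = i + h - l" using assms(1) l by (subst le_mod_geq) auto
    with 2 assms(1) l show "\<not> ((h \<le> i \<longleftrightarrow> h \<le> (i + h) mod l) \<and> (h \<le> i \<longleftrightarrow> h \<le> ((i + h) mod l + h) mod l))"
      by linarith
  next
    case 3
    have "(i + h) mod l = i + h" using 3 h by simp
    moreover have "(i + h + h) mod l = h - 1" using 3 h by (subst le_mod_geq) auto
    ultimately show "\<not> ((h \<le> i \<longleftrightarrow> h \<le> (i + h) mod l) \<and> (h \<le> i \<longleftrightarrow> h \<le> ((i + h) mod l + h) mod l))"
      using 3 h by simp
  qed
qed

context finite_permutation
begin

text \<open>Length \<open>0\<close> on the cycles of length at most \<open>m\<close> makes the rotation below trivial there.\<close>
definition arc_length :: "nat \<Rightarrow> 'a \<Rightarrow> nat" where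
  "arc_length m x = (if card (orbit p x) \<le> m then 0 else card (orbit p x) div 2)"

definition half_rotation :: "nat \<Rightarrow> 'a \<Rightarrow> 'a" where
  "half_rotation m x = (p ^^ rotate_arc (arc_length m x) (pos x)) (rep x)"

lemma arc_length_le: "arc_length m x \<le> card (orbit p x)"
  by (simp add: arc_length_def)

lemma pos_half_rotation: "pos (half_rotation m x) = rotate_arc (arc_length m x) (pos x)"
  unfolding half_rotation_def
  by (intro pos_funpow_rep rotate_arc_less pos_less arc_length_le)

lemma orbit_half_rotation: "orbit p (half_rotation m x) = orbit p x"
  by (simp only: half_rotation_def orbit_funpow orbit_rep)

lemma half_rotation_permutes: "half_rotation m permutes S"
proof (rule bij_imp_permutes)
  have "inj (half_rotation m)"
  proof (rule injI)
    fix x y assume eq: "half_rotation m x = half_rotation m y"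
    have o: "orbit p x = orbit p y" using orbit_half_rotation eq by metis
    then have "arc_length m x = arc_length m y" by (simp add: arc_length_def)
    moreover have "rotate_arc (arc_length m x) (pos x) = rotate_arc (arc_length m y) (pos y)"
      using pos_half_rotation eq by metis
    ultimately have "pos x = pos y" by (simp add: rotate_arc_inject)
    with o show "x = y" by (metis funpow_pos rep_eq_iff)
  qed
  moreover have "half_rotation m ` S \<subseteq> S"
    by (auto simp: half_rotation_def funpow_in_S_iff rep_in_S)
  ultimately show "bij_betw (half_rotation m) S S"
    using endo_inj_surj[OF finite_S] inj_on_subset[OF _ subset_UNIV] unfolding bij_betw_def by blast
next
  fix x assume "x \<notin> S"
  then have "p x = x" by (rule permutes_not_in[OF permutes])
  then have "orbit p x = {x}" by (simp add: orbit_eq_singleton_iff)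
  then have "rep x = x" "arc_length m x = 0" "pos x = 0"
    using rep_in_orbit[of x] pos_less[of x] by (simp_all add: arc_length_def)
  then show "half_rotation m x = x" by (simp add: half_rotation_def rotate_arc_def)
qed

text \<open>A set containing at most one point of each cycle longer than \<open>m\<close>, and no other points, is
  disjoint from its first \<open>m - 1\<close> translates under \<open>p\<close>, which are pairwise disjoint as well.\<close>
lemma card_position_le:
  "m * card {x \<in> S. m < card (orbit p x) \<and> pos x = c (card (orbit p x))} \<le> card S"
    (is "m * card ?B \<le> _")
proof -
  have inj: "inj_on (\<lambda>(i, x). (p ^^ i) x) ({..<m} \<times> ?B)"
  proof (rule inj_onI, clarsimp, rule conjI)
    fix i x j y
    assume ij: "i < m" "j < m" and eq: "(p ^^ i) x = (p ^^ j) y"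
      and xy: "m < card (orbit p x)" "pos x = c (card (orbit p x))"
        "m < card (orbit p y)" "pos y = c (card (orbit p y))"
    have o: "orbit p x = orbit p y" using orbit_funpow eq by metis
    with xy have "pos x = pos y" by simp
    with o show "x = y" by (metis funpow_pos rep_eq_iff)
    then show "i = j" using eq ij xy(1) by (simp add: funpow_eq_iff)
  qed
  have "card ({..<m} \<times> ?B) \<le> card S"
    by (rule card_inj_on_le[OF inj _ finite_S]) (auto simp: funpow_in_S_iff)
  then show ?thesis by (simp add: card_cartesian_product)
qed

text \<open>Commutation can fail only where a step of \<open>p\<close> interferes with the boundary of the arc: at its
  last two positions, and at the last position of the cycle, from which \<open>p\<close> enters the arc.\<close>
lemma half_rotation_commutes:
  assumes "card (orbit p x) \<le> m \<or>
    Suc (Suc (pos x)) \<noteq> arc_length m x \<and> Suc (pos x) \<noteq> arc_length m x \<and> Suc (pos x) \<noteq> card (orbit p x)"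
  shows "p (half_rotation m x) = half_rotation m (p x)"
proof -
  let ?l = "card (orbit p x)" and ?h = "arc_length m x"
  have step: "pos (p x) = Suc (pos x) mod ?l" "rep (p x) = rep x" "arc_length m (p x) = ?h"
    using pos_funpow[of 1 x] rep_funpow[of 1 x] orbit_step_eq[of x] by (simp_all add: arc_length_def)
  have "Suc (rotate_arc ?h (pos x)) mod ?l = rotate_arc ?h (Suc (pos x) mod ?l) mod ?l"
  proof (cases "?l \<le> m")
    case True
    then show ?thesis by (simp add: arc_length_def rotate_arc_def)
  next
    case False
    with assms pos_less[of x] have "Suc (pos x) mod ?l = Suc (pos x)" by simp
    then show ?thesis using assms False by (auto simp: rotate_arc_def)
  qed
  then have "(p ^^ Suc (rotate_arc ?h (pos x))) (rep x)
      = (p ^^ rotate_arc ?h (Suc (pos x) mod ?l)) (rep x)"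
    unfolding funpow_eq_iff orbit_rep .
  then show ?thesis unfolding half_rotation_def step by simp
qed

lemma card_noncommuting_half_rotation:
  "m * card {x \<in> S. p (half_rotation m x) \<noteq> half_rotation m (p x)} \<le> 3 * card S"
proof -
  let ?B = "\<lambda>c. {x \<in> S. m < card (orbit p x) \<and> pos x = c (card (orbit p x))}"
  let ?c1 = "\<lambda>l. l div 2 - 2" and ?c2 = "\<lambda>l. l div 2 - 1" and ?c3 = "\<lambda>l::nat. l - 1"
  have "{x \<in> S. p (half_rotation m x) \<noteq> half_rotation m (p x)} \<subseteq> ?B ?c1 \<union> ?B ?c2 \<union> ?B ?c3"
  proof (intro subsetI, elim CollectE conjE)
    fix x assume x: "x \<in> S" "p (half_rotation m x) \<noteq> half_rotation m (p x)"
    then have "\<not> card (orbit p x) \<le> m" and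
      "Suc (Suc (pos x)) = arc_length m x \<or> Suc (pos x) = arc_length m x \<or> Suc (pos x) = card (orbit p x)"
      using half_rotation_commutes[of x m] by metis+
    moreover from this(1) have "arc_length m x = card (orbit p x) div 2" by (simp add: arc_length_def)
    ultimately show "x \<in> ?B ?c1 \<union> ?B ?c2 \<union> ?B ?c3" using x(1) by auto
  qed
  then have "card {x \<in> S. p (half_rotation m x) \<noteq> half_rotation m (p x)}
      \<le> card (?B ?c1 \<union> ?B ?c2 \<union> ?B ?c3)"
    by (rule card_mono[rotated]) (use finite_S in simp)
  also have "\<dots> \<le> card (?B ?c1) + card (?B ?c2) + card (?B ?c3)"
    by (rule order_trans[OF card_Un_le add_right_mono[OF card_Un_le]])
  finally have "m * card {x \<in> S. p (half_rotation m x) \<noteq> half_rotation m (p x)}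
      \<le> m * card (?B ?c1) + m * card (?B ?c2) + m * card (?B ?c3)"
    unfolding distrib_left[symmetric] by (rule mult_le_mono2)
  also have "\<dots> \<le> card S + card S + card S"
    by (rule add_mono[OF add_mono[OF card_position_le card_position_le] card_position_le])
  also have "\<dots> = 3 * card S" by simp
  finally show ?thesis .
qed

text \<open>For \<open>m \<ge> 3\<close> the arc has at least two points, so rotating it moves all of them.\<close>
lemma half_rotation_fixed_iff:
  assumes "3 \<le> m" "m < card (orbit p x)"
  shows "half_rotation m x = x \<longleftrightarrow> card (orbit p x) div 2 \<le> pos x"
proof -
  have "half_rotation m x = x \<longleftrightarrow> pos (half_rotation m x) = pos x"
    by (metis funpow_pos orbit_half_rotation rep_eq_iff)
  also have "\<dots> \<longleftrightarrow> card (orbit p x) div 2 \<le> pos x"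
    unfolding pos_half_rotation using assms by (auto simp: arc_length_def rotate_arc_def)
  finally show ?thesis .
qed

lemma commuting_fixed_on_orbit:
  assumes "p \<circ> g = g \<circ> p" "inj g"
  shows "g ((p ^^ j) x) = (p ^^ j) x \<longleftrightarrow> g x = x"
proof -
  have "g (p y) = p (g y)" for y
    using fun_cong[OF assms(1), of y] by simp
  then have "g ((p ^^ j) x) = (p ^^ j) (g x)" by (induction j) simp_all
  moreover have "inj (p ^^ j)" by (rule inj_fn[OF permutes_inj[OF permutes]])
  ultimately show ?thesis by (simp add: inj_eq)
qed

text \<open>The set fixed by \<open>g\<close> contains each cycle or misses it, whereas \<open>half_rotation m\<close> fixes one
  half of each long cycle and moves the other half. Let \<open>s\<close> advance each point by half the length
  of its cycle. Among \<open>x\<close>, \<open>s x\<close> and \<open>s (s x)\<close> both halves occur, so the two permutations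
  disagree at one of these points; as \<open>s\<close> is injective, this bounds the number of points on long
  cycles by three times the number of disagreements.\<close>
lemma half_rotation_far_from_commuting:
  assumes g: "g permutes S" "p \<circ> g = g \<circ> p" and m: "3 \<le> m"
  shows "card {x \<in> S. m < card (orbit p x)} \<le> 3 * card {x \<in> S. half_rotation m x \<noteq> g x}"
proof -
  let ?D = "{x \<in> S. half_rotation m x \<noteq> g x}"
  define s where "s x = (p ^^ (card (orbit p x) div 2)) x" for x
  have o: "orbit p (s x) = orbit p x" for x by (simp only: s_def orbit_funpow)
  have inj_s: "inj s"
  proof (rule injI)
    fix x y assume eq: "s x = s y"
    have "orbit p x = orbit p y" using o eq by metis
    then show "x = y"
      using eq inj_fn[OF permutes_inj[OF permutes]] by (simp add: s_def inj_eq)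
  qed
  have s_S: "s x \<in> S \<longleftrightarrow> x \<in> S" for x by (simp add: s_def funpow_in_S_iff)
  have fix_s: "g (s x) = s x \<longleftrightarrow> g x = x" for x
    unfolding s_def by (rule commuting_fixed_on_orbit[OF g(2) permutes_inj[OF g(1)]])
  have pos_s: "pos (s x) = (pos x + card (orbit p x) div 2) mod card (orbit p x)" for x
    unfolding s_def by (rule pos_funpow)
  have cover: "{x \<in> S. m < card (orbit p x)} \<subseteq> ?D \<union> {x \<in> S. s x \<in> ?D} \<union> {x \<in> S. s (s x) \<in> ?D}"
  proof (rule subsetI, rule ccontr)
    fix x assume x: "x \<in> {x \<in> S. m < card (orbit p x)}"
      and not: "x \<notin> ?D \<union> {x \<in> S. s x \<in> ?D} \<union> {x \<in> S. s (s x) \<in> ?D}"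
    let ?l = "card (orbit p x)" and ?h = "card (orbit p x) div 2"
    have eq: "half_rotation m x = g x" "half_rotation m (s x) = g (s x)"
      "half_rotation m (s (s x)) = g (s (s x))"
      using x not s_S by auto
    have l: "m < ?l" using x by simp
    have "(?h \<le> pos x) = (g x = x)" "(?h \<le> pos (s x)) = (g x = x)"
      "(?h \<le> pos (s (s x))) = (g x = x)"
      using half_rotation_fixed_iff[OF m, of x] half_rotation_fixed_iff[OF m, of "s x"]
        half_rotation_fixed_iff[OF m, of "s (s x)"] l eq fix_s o by simp_all
    then show False
      using half_shifts_meet_both_halves[OF pos_less[of x]] m l
      unfolding pos_s o by linarith
  qed
  have card_le: "card {x \<in> S. t x \<in> ?D} \<le> card ?D" if "inj t" for t :: "'a \<Rightarrow> 'a"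
  proof (rule card_inj_on_le)
    show "inj_on t {x \<in> S. t x \<in> ?D}" by (rule inj_on_subset[OF that subset_UNIV])
    show "t ` {x \<in> S. t x \<in> ?D} \<subseteq> ?D" by blast
    show "finite ?D" using finite_S by simp
  qed
  have "card {x \<in> S. m < card (orbit p x)}
      \<le> card (?D \<union> {x \<in> S. s x \<in> ?D} \<union> {x \<in> S. s (s x) \<in> ?D})"
    by (rule card_mono[OF _ cover]) (use finite_S in simp)
  also have "\<dots> \<le> card ?D + card {x \<in> S. s x \<in> ?D} + card {x \<in> S. s (s x) \<in> ?D}"
    by (rule order_trans[OF card_Un_le add_right_mono[OF card_Un_le]])
  also have "\<dots> \<le> card ?D + card ?D + card ?D"
    using card_le[OF inj_s] card_le[OF inj_compose[OF inj_s inj_s]]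
    unfolding comp_apply by (intro add_mono order_refl)
  finally show ?thesis by simp
qed

end

section \<open>The sofic group in terms of representatives\<close>

lemma sofic_class_eq_iff:
  assumes p: "p \<in> carrier (sym_product n)" and q: "q \<in> carrier (sym_product n)"
  shows "sofic_class \<omega> n p = sofic_class \<omega> n q \<longleftrightarrow>
    ((\<lambda>k. hamming (n k) (p k) (q k)) \<longlongrightarrow> 0) \<omega>"
proof
  assume "sofic_class \<omega> n p = sofic_class \<omega> n q"
  moreover have "q \<in> sofic_class \<omega> n q"
    using q unfolding sofic_class_iff[OF q] by (simp add: hamming_def)
  ultimately show "((\<lambda>k. hamming (n k) (p k) (q k)) \<longlongrightarrow> 0) \<omega>"
    using sofic_class_iff[OF p] by blast
next
  assume "((\<lambda>k. hamming (n k) (p k) (q k)) \<longlongrightarrow> 0) \<omega>"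
  then have "q \<in> sofic_class \<omega> n p" using sofic_class_iff[OF p] q by blast
  then show "sofic_class \<omega> n p = sofic_class \<omega> n q"
    unfolding sofic_class_def
    by (rule group.repr_independence[OF group_sym_product _ p
          normal_imp_subgroup[OF normal_null_sequences]])
qed

lemma sofic_class_mult:
  assumes "p \<in> carrier (sym_product n)" "q \<in> carrier (sym_product n)"
  shows "sofic_class \<omega> n p \<otimes>\<^bsub>universal_sofic_group \<omega> n\<^esub> sofic_class \<omega> n q
    = sofic_class \<omega> n (\<lambda>k. p k \<circ> q k)"
  using normal.rcos_sum[OF normal_null_sequences assms]
  by (simp add: universal_sofic_group_def sofic_class_def mult_sym_product)

lemma carrier_universal_sofic_group:
  "carrier (universal_sofic_group \<omega> n) = sofic_class \<omega> n ` carrier (sym_product n)"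
  by (simp add: universal_sofic_group_def carrier_FactGroup sofic_class_def)

lemma comp_sym_product:
  "p \<in> carrier (sym_product n) \<Longrightarrow> q \<in> carrier (sym_product n) \<Longrightarrow>
    (\<lambda>k. p k \<circ> q k) \<in> carrier (sym_product n)"
  by (simp add: carrier_sym_product permutes_compose)

lemma stable_centralizer_iff:
  assumes p: "p \<in> carrier (sym_product n)"
  shows "stable_centralizer \<omega> n p \<longleftrightarrow>
    (\<forall>q \<in> carrier (sym_product n).
      ((\<lambda>k. hamming (n k) (p k \<circ> q k) (q k \<circ> p k)) \<longlongrightarrow> 0) \<omega> \<longrightarrow>
      (\<exists>r \<in> carrier (sym_product n).
        ((\<lambda>k. hamming (n k) (q k) (r k)) \<longlongrightarrow> 0) \<omega> \<and> (\<forall>k. p k \<circ> r k = r k \<circ> p k)))"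
  unfolding stable_centralizer_def carrier_universal_sofic_group ball_simps
  by (intro ball_cong imp_cong bex_cong refl)
    (simp_all add: sofic_class_mult sofic_class_eq_iff comp_sym_product p sym_group_def)

section \<open>The proportion of points on long cycles\<close>

definition long_fraction :: "nat \<Rightarrow> nat \<Rightarrow> (nat \<Rightarrow> nat) \<Rightarrow> real" where
  "long_fraction m n p = real (card {x \<in> {1..n}. m < card (orbit p x)}) / real n"

text \<open>This turns the series that defines \<open>sofic_cyc_inf\<close> into the proportions controlled by the
  counting lemmas above.\<close>
lemma long_fraction_eq:
  assumes p: "p permutes {1..n}" and n: "0 < n"
  shows "long_fraction m n p = 1 - (\<Sum>i<m. cyc (Suc i) n p)"
proof -
  interpret finite_permutation "{1..n}" p
    by unfold_locales (use p in auto)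
  let ?C = "\<lambda>i. {x \<in> {1..n}. card (orbit p x) = Suc i}"
  let ?L = "{x \<in> {1..n}. m < card (orbit p x)}"
  have "{1..n} = (\<Union>i<m. ?C i) \<union> ?L"
  proof (intro Set.set_eqI iffI)
    fix x assume x: "x \<in> {1..n}"
    obtain i where i: "card (orbit p x) = Suc i"
      using card_orbit_pos[of x] gr0_implies_Suc by blast
    show "x \<in> (\<Union>i<m. ?C i) \<union> ?L"
    proof (cases "i < m")
      case True
      then show ?thesis using x i by blast
    next
      case False
      then show ?thesis using x i by simp
    qed
  qed blast
  then have "card {1..n} = card ((\<Union>i<m. ?C i) \<union> ?L)" by (rule arg_cong)
  also have "\<dots> = card (\<Union>i<m. ?C i) + card ?L"
    by (rule card_Un_disjoint) auto
  also have "card (\<Union>i<m. ?C i) = (\<Sum>i<m. card (?C i))"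
    by (rule card_UN_disjoint) auto
  finally have "n = (\<Sum>i<m. card (?C i)) + card ?L"
    by (simp only: card_atLeastAtMost diff_Suc_1)
  then have "real n = real ((\<Sum>i<m. card (?C i)) + card ?L)" by (rule arg_cong)
  then have "real (card ?L) = real n - (\<Sum>i<m. real (card (?C i)))"
    by (simp only: of_nat_add of_nat_sum)
  then show ?thesis
    using n unfolding long_fraction_def cyc_def cyc_set_eq[OF p]
    by (simp only: diff_divide_distrib sum_divide_distrib) simp
qed

lemma long_fraction_tendsto:
  assumes "ultrafilter \<omega>" "\<forall>k. 0 < n k" "p \<in> carrier (sym_product n)"
  shows "((\<lambda>k. long_fraction m (n k) (p k)) \<longlongrightarrow>
    1 - (\<Sum>i<m. sofic_cyc \<omega> n (Suc i) (sofic_class \<omega> n p))) \<omega>"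
proof -
  have "long_fraction m (n k) (p k) = 1 - (\<Sum>i<m. cyc (Suc i) (n k) (p k))" for k
    using assms(2,3) by (intro long_fraction_eq) (auto simp: carrier_sym_product)
  then show ?thesis
    by (simp only:) (intro tendsto_intros sofic_cyc_tendsto assms(1,3))
qed

lemma sofic_cyc_inf_tendsto:
  assumes "ultrafilter \<omega>" "p \<in> carrier (sym_product n)"
  shows "(\<lambda>m. 1 - (\<Sum>i<m. sofic_cyc \<omega> n (Suc i) (sofic_class \<omega> n p)))
    \<longlonglongrightarrow> sofic_cyc_inf \<omega> n (sofic_class \<omega> n p)"
  unfolding sofic_cyc_inf_def
  by (intro tendsto_intros summable_LIMSEQ summable_sofic_cyc(1)[OF assms])

text \<open>At every stage \<open>m\<close>, the limiting proportion of points on cycles longer than \<open>m\<close> is an upper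
  bound, which guarantees enough long cycles for each fixed \<open>m\<close>.\<close>
lemma sofic_cyc_inf_le:
  assumes \<omega>: "ultrafilter \<omega>" and p: "p \<in> carrier (sym_product n)"
  shows "sofic_cyc_inf \<omega> n (sofic_class \<omega> n p)
    \<le> 1 - (\<Sum>i<m. sofic_cyc \<omega> n (Suc i) (sofic_class \<omega> n p))"
proof -
  have "\<omega> \<noteq> bot" using \<omega> by (simp add: ultrafilter_def)
  then have "0 \<le> sofic_cyc \<omega> n i (sofic_class \<omega> n p)" for i
    by (intro tendsto_lowerbound[OF sofic_cyc_tendsto[OF \<omega> p]]) (simp_all add: cyc_nonneg)
  then show ?thesis
    unfolding sofic_cyc_inf_def by (simp add: sum_le_suminf[OF summable_sofic_cyc(1)[OF \<omega> p]])
qed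

section \<open>Diagonalising along a nonprincipal ultrafilter\<close>

text \<open>An ultrafilter for which \<open>{x}\<close> is large consists of exactly the sets containing \<open>x\<close>; so
  for a nonprincipal one every singleton, and hence every finite set, is small.\<close>
lemma nonprincipal_eventually_ge:
  fixes \<omega> :: "nat filter"
  assumes "nonprincipal_ultrafilter \<omega>"
  shows "eventually (\<lambda>k. M \<le> k) \<omega>"
proof -
  have ne: "eventually (\<lambda>k. k \<noteq> x) \<omega>" for x
  proof (rule ccontr)
    assume not: "\<not> eventually (\<lambda>k. k \<noteq> x) \<omega>"
    have "eventually P \<omega> \<longleftrightarrow> P x" for P
    proof
      assume P: "eventually P \<omega>"
      show "P x"
      proof (rule ccontr)
        assume "\<not> P x"
        with P have "eventually (\<lambda>k. k \<noteq> x) \<omega>" by (auto elim: eventually_mono)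
        with not show False ..
      qed
    next
      assume "P x"
      show "eventually P \<omega>"
      proof (rule ccontr)
        assume "\<not> eventually P \<omega>"
        then have "eventually (\<lambda>k. \<not> P k) \<omega>"
          using assms by (auto simp: nonprincipal_ultrafilter_def ultrafilter_def)
        with \<open>P x\<close> have "eventually (\<lambda>k. k \<noteq> x) \<omega>" by (auto elim: eventually_mono)
        with not show False ..
      qed
    qed
    then have "\<omega> = principal {x}" by (simp add: filter_eq_iff eventually_principal)
    then show False using assms by (simp add: nonprincipal_ultrafilter_def)
  qed
  then have "eventually (\<lambda>k. \<forall>x\<in>{..<M}. k \<noteq> x) \<omega>"
    by (intro eventually_ball_finite) auto
  then show ?thesis by (rule eventually_mono) (auto simp: not_less[symmetric])
qed

text \<open>Properties that hold eventually for each fixed \<open>m\<close> hold with \<open>m\<close> growing along the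
  ultrafilter: at \<open>k\<close> take the largest \<open>M \<le> k\<close> such that the properties with index up to \<open>M\<close> all
  hold at \<open>k\<close>. The cutoff at \<open>k\<close> makes the maximum exist; it does no harm since every tail of
  the natural numbers is large for a nonprincipal ultrafilter.\<close>
lemma nonprincipal_diagonal:
  fixes \<omega> :: "nat filter" and P :: "nat \<Rightarrow> nat \<Rightarrow> bool"
  assumes \<omega>: "nonprincipal_ultrafilter \<omega>" and P: "\<And>m. eventually (P m) \<omega>"
  shows "\<exists>m. filterlim m at_top \<omega> \<and> eventually (\<lambda>k. P (m k) k) \<omega>"
proof -
  let ?Q = "\<lambda>k M. M \<le> k \<and> (\<forall>i\<le>M. P i k)"
  define m where "m k = (GREATEST M. ?Q k M)" for k
  have Q: "eventually (\<lambda>k. ?Q k M) \<omega>" for M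
  proof -
    have "eventually (\<lambda>k. \<forall>i\<in>{..M}. P i k) \<omega>"
      using P by (intro eventually_ball_finite) auto
    with nonprincipal_eventually_ge[OF \<omega>, of M] show ?thesis
      by eventually_elim auto
  qed
  have "eventually (\<lambda>k. M \<le> m k) \<omega>" for M
    using Q[of M]
    by eventually_elim (auto simp: m_def intro!: Greatest_le_nat[of "?Q _" _ _])
  moreover have "eventually (\<lambda>k. P (m k) k) \<omega>"
    using Q[of 0]
  proof eventually_elim
    case (elim k)
    then have "?Q k (m k)"
      unfolding m_def by (rule GreatestI_nat[of "?Q k" 0 k]) simp
    then show ?case by blast
  qed
  ultimately show ?thesis by (auto simp: filterlim_at_top)
qed

section \<open>The two implications\<close>

lemma stable_centralizer_if_sofic_cyc_inf_0:
  assumes \<omega>: "ultrafilter \<omega>" and n: "\<forall>k. 0 < n k" and p: "p \<in> carrier (sym_product n)"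
    and inf: "sofic_cyc_inf \<omega> n (sofic_class \<omega> n p) = 0"
  shows "stable_centralizer \<omega> n p"
  unfolding stable_centralizer_iff[OF p]
proof (intro ballI impI)
  fix q assume q: "q \<in> carrier (sym_product n)"
    and comm: "((\<lambda>k. hamming (n k) (p k \<circ> q k) (q k \<circ> p k)) \<longlongrightarrow> 0) \<omega>"
  have "\<exists>g. g permutes {1..n k} \<and> p k \<circ> g = g \<circ> p k \<and>
      (\<forall>m. hamming (n k) (q k) g \<le>
        long_fraction m (n k) (p k) + real m * hamming (n k) (p k \<circ> q k) (q k \<circ> p k))" for k
  proof -
    interpret finite_permutation "{1..n k}" "p k"
      by unfold_locales (use p in \<open>auto simp: carrier_sym_product\<close>)
    have "q k permutes {1..n k}" using q by (simp add: carrier_sym_product)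
    then obtain g where g: "g permutes {1..n k}" "p k \<circ> g = g \<circ> p k"
      and le: "\<And>m. card {x \<in> {1..n k}. q k x \<noteq> g x} \<le>
        card {x \<in> {1..n k}. m < card (orbit (p k) x)} +
        m * card {x \<in> {1..n k}. p k (q k x) \<noteq> q k (p k x)}"
      using approximate_by_commuting by blast
    have "hamming (n k) (q k) g \<le>
        long_fraction m (n k) (p k) + real m * hamming (n k) (p k \<circ> q k) (q k \<circ> p k)" for m
    proof -
      have "real (card {x \<in> {1..n k}. q k x \<noteq> g x}) \<le>
        real (card {x \<in> {1..n k}. m < card (orbit (p k) x)}) +
        real m * real (card {x \<in> {1..n k}. p k (q k x) \<noteq> q k (p k x)})"
        using le[of m] by (simp only: of_nat_add[symmetric] of_nat_mult[symmetric] of_nat_le_iff)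
      from divide_right_mono[OF this, of "real (n k)"] show ?thesis
        by (simp add: hamming_def long_fraction_def add_divide_distrib)
    qed
    with g show ?thesis by blast
  qed
  then obtain r where r: "\<And>k. r k permutes {1..n k}" "\<And>k. p k \<circ> r k = r k \<circ> p k"
    and le: "\<And>k m. hamming (n k) (q k) (r k) \<le>
        long_fraction m (n k) (p k) + real m * hamming (n k) (p k \<circ> q k) (q k \<circ> p k)"
    by metis
  have "((\<lambda>k. hamming (n k) (q k) (r k)) \<longlongrightarrow> 0) \<omega>"
  proof (rule order_tendstoI)
    fix e :: real assume "e < 0"
    then show "eventually (\<lambda>k. e < hamming (n k) (q k) (r k)) \<omega>"
      using less_le_trans[OF _ hamming_nonneg] by (intro always_eventually) blast
  next
    fix e :: real assume e: "0 < e"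
    let ?t = "\<lambda>m. 1 - (\<Sum>i<m. sofic_cyc \<omega> n (Suc i) (sofic_class \<omega> n p))"
    have "eventually (\<lambda>m. ?t m < e) sequentially"
      using sofic_cyc_inf_tendsto[OF \<omega> p] inf e by (intro order_tendstoD(2)) auto
    then obtain m where m: "?t m < e" by (auto simp: eventually_sequentially)
    have "((\<lambda>k. long_fraction m (n k) (p k) +
        real m * hamming (n k) (p k \<circ> q k) (q k \<circ> p k)) \<longlongrightarrow> ?t m + real m * 0) \<omega>"
      by (intro tendsto_intros long_fraction_tendsto \<omega> n p comm)
    then have "eventually (\<lambda>k. long_fraction m (n k) (p k) +
        real m * hamming (n k) (p k \<circ> q k) (q k \<circ> p k) < e) \<omega>"
      using m by (intro order_tendstoD(2)) auto
    then show "eventually (\<lambda>k. hamming (n k) (q k) (r k) < e) \<omega>"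
      by (rule eventually_mono) (rule le_less_trans[OF le])
  qed
  moreover have "r \<in> carrier (sym_product n)" using r(1) by (simp add: carrier_sym_product)
  ultimately show "\<exists>r \<in> carrier (sym_product n).
      ((\<lambda>k. hamming (n k) (q k) (r k)) \<longlongrightarrow> 0) \<omega> \<and> (\<forall>k. p k \<circ> r k = r k \<circ> p k)"
    using r(2) by blast
qed

lemma hamming_half_rotation:
  assumes p: "p permutes {1..n}" and n: "0 < n" and m: "3 \<le> m"
  defines "q \<equiv> finite_permutation.half_rotation p m"
  shows "q permutes {1..n}"
    and "hamming n (p \<circ> q) (q \<circ> p) \<le> 3 / real m"
    and "g permutes {1..n} \<Longrightarrow> p \<circ> g = g \<circ> p \<Longrightarrow> long_fraction m n p \<le> 3 * hamming n q g"
proof -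
  interpret finite_permutation "{1..n}" p
    by unfold_locales (use p in auto)
  show "q permutes {1..n}" unfolding q_def by (rule half_rotation_permutes)
  have "m * card {x \<in> {1..n}. p (q x) \<noteq> q (p x)} \<le> 3 * n"
    using card_noncommuting_half_rotation[of m, folded q_def] by (simp only: card_atLeastAtMost diff_Suc_1)
  from of_nat_mono[OF this, where 'a = real]
  have "real m * real (card {x \<in> {1..n}. p (q x) \<noteq> q (p x)}) \<le> 3 * real n" by simp
  then show "hamming n (p \<circ> q) (q \<circ> p) \<le> 3 / real m"
    using n m by (simp add: hamming_def field_simps)
  assume "g permutes {1..n}" "p \<circ> g = g \<circ> p"
  from half_rotation_far_from_commuting[OF this m, folded q_def]
  have "real (card {x \<in> {1..n}. m < card (orbit p x)}) \<le> 3 * real (card {x \<in> {1..n}. q x \<noteq> g x})"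
    by linarith
  from divide_right_mono[OF this, of "real n"]
  show "long_fraction m n p \<le> 3 * hamming n q g"
    by (simp add: long_fraction_def hamming_def)
qed

lemma sofic_cyc_inf_0_if_stable_centralizer:
  assumes \<omega>: "nonprincipal_ultrafilter \<omega>" and n: "\<forall>k. 0 < n k"
    and p: "p \<in> carrier (sym_product n)"
    and stable: "stable_centralizer \<omega> n p"
  shows "sofic_cyc_inf \<omega> n (sofic_class \<omega> n p) = 0"
proof (rule ccontr)
  let ?c = "sofic_cyc_inf \<omega> n (sofic_class \<omega> n p)"
  assume "?c \<noteq> 0"
  have uf: "ultrafilter \<omega>" using \<omega> by (simp add: nonprincipal_ultrafilter_def)
  then have nb: "\<omega> \<noteq> bot" by (simp add: ultrafilter_def)
  have c: "0 < ?c" using \<open>?c \<noteq> 0\<close> summable_sofic_cyc(2)[OF uf p] by simp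
  have pk: "p k permutes {1..n k}" for k using p by (simp add: carrier_sym_product)
  have "eventually (\<lambda>k. ?c / 2 < long_fraction m (n k) (p k)) \<omega>" for m
    by (rule order_tendstoD(1)[OF long_fraction_tendsto[OF uf n p]])
      (use sofic_cyc_inf_le[OF uf p, of m] c in linarith)
  then obtain m where m: "filterlim m at_top \<omega>"
    and long: "eventually (\<lambda>k. ?c / 2 < long_fraction (m k) (n k) (p k)) \<omega>"
    using nonprincipal_diagonal[OF \<omega>, of "\<lambda>m k. ?c / 2 < long_fraction m (n k) (p k)"] by blast
  have m3: "eventually (\<lambda>k. 3 \<le> m k) \<omega>" using m by (simp add: filterlim_at_top)
  \<comment> \<open>The indices with \<open>m k < 3\<close> form a small set for \<open>\<omega>\<close>; any permutation will do there.\<close>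
  define q where "q k = (if 3 \<le> m k then finite_permutation.half_rotation (p k) (m k) else id)" for k
  have q: "q \<in> carrier (sym_product n)"
    using hamming_half_rotation(1)[OF pk] n by (simp add: carrier_sym_product q_def permutes_id)
  have "((\<lambda>k. hamming (n k) (p k \<circ> q k) (q k \<circ> p k)) \<longlongrightarrow> 0) \<omega>"
  proof (rule Lim_null_comparison)
    show "eventually (\<lambda>k. norm (hamming (n k) (p k \<circ> q k) (q k \<circ> p k)) \<le> 3 / real (m k)) \<omega>"
      using m3
    proof eventually_elim
      case (elim k)
      then show ?case
        using hamming_half_rotation(2)[OF pk _ elim, of k] n hamming_nonneg by (simp add: q_def)
    qed
    show "((\<lambda>k. 3 / real (m k)) \<longlongrightarrow> 0) \<omega>"
      by (intro tendsto_divide_0[OF tendsto_const] filterlim_at_top_imp_at_infinity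
          filterlim_compose[OF filterlim_real_sequentially m])
  qed
  then obtain r where r: "r \<in> carrier (sym_product n)"
    "((\<lambda>k. hamming (n k) (q k) (r k)) \<longlongrightarrow> 0) \<omega>" "\<And>k. p k \<circ> r k = r k \<circ> p k"
    using stable q unfolding stable_centralizer_iff[OF p] by blast
  have "eventually (\<lambda>k. hamming (n k) (q k) (r k) < ?c / 6) \<omega>"
    using r(2) c by (intro order_tendstoD(2)) auto
  with m3 long have "eventually (\<lambda>k. False) \<omega>"
  proof eventually_elim
    case (elim k)
    have "long_fraction (m k) (n k) (p k) \<le> 3 * hamming (n k) (q k) (r k)"
      using hamming_half_rotation(3)[OF pk _ elim(1) _ r(3), of k] n r(1) elim(1)
      by (simp add: q_def carrier_sym_product)
    with elim show False by linarith
  qed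
  with nb show False by simp
qed

theorem theorem4p3:
  fixes \<omega> :: "nat filter" and n :: "nat \<Rightarrow> nat" and p :: "nat \<Rightarrow> nat \<Rightarrow> nat"
  assumes "nonprincipal_ultrafilter \<omega>"
    and "\<forall>k. n k > 0"
    and "p \<in> carrier (sym_product n)"
  shows "stable_centralizer \<omega> n p \<longleftrightarrow> sofic_cyc_inf \<omega> n (sofic_class \<omega> n p) = 0"
proof
  show "sofic_cyc_inf \<omega> n (sofic_class \<omega> n p) = 0" if "stable_centralizer \<omega> n p"
    by (rule sofic_cyc_inf_0_if_stable_centralizer[OF assms that])
  show "stable_centralizer \<omega> n p" if "sofic_cyc_inf \<omega> n (sofic_class \<omega> n p) = 0"
    using assms(1) by (intro stable_centralizer_if_sofic_cyc_inf_0[OF _ assms(2,3) that])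
      (simp add: nonprincipal_ultrafilter_def)
qed

end
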